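(* Let $S=s_1\mathbb{N}_0+\cdots+s_k\mathbb{N}_0$ be a numerical semigroup, where $s_1,\ldots,s_k$ are positive integers. Then the algorithm StdBasis (described in the context), applied to the input list $[s_1,\ldots,s_k]$, computes the standard basis of $S$; that is, it terminates and the returned list $T$ is the standard basis $[m,h_1,\ldots,h_{m-1}]$ of $S$.
   Context: $\mathbb{N}_0$ is the set of non-negative integers. A numerical semigroup is an additive submonoid $S$ of $\mathbb{N}_0$ with finite complement. Its multiplicity $m$ is the smallest element of $S\setminus\{0\}$. Its standard basis is the list $[m,h_1,\ldots,h_{m-1}]$, where for $1\le i\le m-1$, $h_i$ is the smallest element of $S$ congruent to $i$ modulo $m$. Algorithm StdBasis. Input: $Gen=[s_1,\ldots,s_k]$. Set $m\leftarrow\min(s_1,\ldots,s_k)$. Let $T$ be a list indexed by $0,\ldots,m-1$, and initialize $T[i]\leftarrow\inf\{t\in Gen: t\equiv i \pmod m\}$ for $i=0,\ldots,m-1$, with $\inf(\emptyset)=\infty$ (and the usual conventions for arithmetic and comparison with $\infty$). Then repeat the following pass: for $i=1,\ldots,m-1$ in order, and for each such $i$, for $j=i,\ldots,m-1$ in order, let $r\in\{0,\ldots,m-1\}$ be the remainder of $i+j$ modulo $m$; if $T[r]>T[i]+T[j]$, set $T[r]\leftarrow T[i]+T[j]$. The algorithm performs at least one pass and stops after the first pass in which no entry of $T$ was changed. It returns $T$. *)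

theory Defs
  imports "HOL-Library.Extended_Nat" "HOL-Library.While_Combinator" "HOL-Number_Theory.Cong"
begin

definition numerical_semigroup :: "nat set \<Rightarrow> bool" where
  "numerical_semigroup S \<longleftrightarrow>
     0 \<in> S \<and> (\<forall>a\<in>S. \<forall>b\<in>S. a + b \<in> S) \<and> finite (UNIV - S)"

definition generated_by :: "nat list \<Rightarrow> nat set" where
  "generated_by gen = {\<Sum>i<length gen. gen ! i * c i | c :: nat \<Rightarrow> nat. True}"

definition semigroup_multiplicity :: "nat set \<Rightarrow> nat" where
  "semigroup_multiplicity S = (LEAST x. x \<in> S - {0})"

definition standard_basis :: "nat set \<Rightarrow> nat list" where
  "standard_basis S =
     (let m = semigroup_multiplicity S
      in m # map (\<lambda>i. LEAST x. x \<in> S \<and> [x = i] (mod m)) [1..<m])"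

(* In type enat the infimum of the empty set is \<infinity>. *)
definition init_table :: "nat \<Rightarrow> nat list \<Rightarrow> enat list" where
  "init_table m gen = map (\<lambda>i. INF t \<in> {t \<in> set gen. [t = i] (mod m)}. enat t) [0..<m]"

(* The loop state is the table T together with a flag recording whether some entry of T
   has been changed during the current pass. *)
definition relax :: "nat \<Rightarrow> nat \<Rightarrow> nat \<Rightarrow> enat list \<times> bool \<Rightarrow> enat list \<times> bool" where
  "relax m i j = (\<lambda>(T, changed).
     let r = (i + j) mod m
     in if T ! r > T ! i + T ! j then (T[r := T ! i + T ! j], True) else (T, changed))"

definition pass :: "nat \<Rightarrow> enat list \<Rightarrow> enat list \<times> bool" where
  "pass m T = fold (\<lambda>i. fold (\<lambda>j. relax m i j) [i..<m]) [1..<m] (T, False)"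

(* The result None means that the loop does not terminate.  The initial flag True forces
   the first pass. *)
definition StdBasis :: "nat list \<Rightarrow> enat list option" where
  "StdBasis gen =
     (let m = Min (set gen)
      in map_option fst
           (while_option (\<lambda>(T, changed). changed) (\<lambda>(T, changed). pass m T)
              (init_table m gen, True)))"

end

theory Submission
  imports Defs
begin

text \<open>
  Let \<open>m\<close> be the least generator; it is also the least positive element of \<open>S\<close>.  Throughout the
  run every finite entry \<open>T ! i\<close> is a positive element of \<open>S\<close> congruent to \<open>i\<close>, since the sum of
  two such entries is again one (\<open>relax_invariant\<close>), and the entries only decrease.  So \<open>T ! i\<close>
  never drops below \<open>h\<^sub>i\<close> and \<open>T ! 0\<close> keeps its initial value \<open>m\<close>.

  A pass either leaves the table alone or strictly decreases it componentwise
  (\<open>fold_relax\<close>).  Since the order on \<open>enat\<close> is well-founded, so is the lexicographic order on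
  tables, and the loop stops.

  When it stops, the table is subadditive: \<open>T ! ((i + j) mod m) \<le> T ! i + T ! j\<close>
  for all nonzero residues \<open>i\<close>, \<open>j\<close>.  Because the table started below the generators, adding one
  generator at a time shows that \<open>T ! (x mod m) \<le> x\<close> for every positive \<open>x\<close> in \<open>S\<close>
  (\<open>closed_table_le\<close>).  In particular \<open>T ! i \<le> h\<^sub>i\<close>, and the two bounds meet.  The finite
  complement of \<open>S\<close> is what makes every \<open>h\<^sub>i\<close>, hence every final entry, finite.
\<close>

section \<open>The monoid generated by a list\<close>

lemma generated_by_induct [consumes 1, case_names zero add]:
  assumes "x \<in> generated_by gen"
    and zero: "P 0"
    and add: "\<And>t y. t \<in> set gen \<Longrightarrow> P y \<Longrightarrow> P (y + t)"
  shows "P x"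
proof -
  from assms(1) obtain c where x: "x = (\<Sum>i<length gen. gen ! i * c i)"
    unfolding generated_by_def by auto
  have multiple: "P (y + t * k)" if "t \<in> set gen" "P y" for t y k
  proof (induction k)
    case (Suc k)
    from add[OF that(1) Suc] show ?case by (simp add: ac_simps)
  qed (use that in simp)
  have "P (\<Sum>i<n. gen ! i * c i)" if "n \<le> length gen" for n
    using that
  proof (induction n)
    case (Suc n)
    then have "P ((\<Sum>i<n. gen ! i * c i) + gen ! n * c n)" by (intro multiple) auto
    then show ?case by simp
  qed (simp add: zero)
  from this[OF order.refl] show ?thesis unfolding x .
qed

lemma generator_in_generated_by:
  assumes "t \<in> set gen"
  shows "t \<in> generated_by gen"
proof -
  from assms obtain k where k: "k < length gen" "gen ! k = t"
    unfolding in_set_conv_nth by blast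
  have "(\<Sum>i<length gen. gen ! i * (if i = k then 1 else 0)) =
      (\<Sum>i<length gen. if i = k then gen ! i else 0)"
    by (rule sum.cong) auto
  also have "\<dots> = t" using k by simp
  finally have "t = (\<Sum>i<length gen. gen ! i * (if i = k then 1 else 0))"
    by (rule sym)
  then show ?thesis
    unfolding generated_by_def mem_Collect_eq
    by (intro exI[of _ "\<lambda>i. if i = k then 1 else 0"] conjI TrueI)
qed

lemma Min_le_generated_by:
  assumes "x \<in> generated_by gen" and "x \<noteq> 0"
  shows "Min (set gen) \<le> x"
proof -
  from assms(1) have "x = 0 \<or> Min (set gen) \<le> x"
  proof (induction rule: generated_by_induct)
    case (add t y)
    have "Min (set gen) \<le> t" using add(1) by simp
    then show ?case by simp
  qed simp
  with assms(2) show ?thesis by simp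
qed

lemma semigroup_multiplicity_generated_by:
  assumes "gen \<noteq> []" and "\<forall>t\<in>set gen. 0 < t"
  shows "semigroup_multiplicity (generated_by gen) = Min (set gen)"
  unfolding semigroup_multiplicity_def
proof (rule Least_equality)
  have "Min (set gen) \<in> set gen" using assms(1) by simp
  then show "Min (set gen) \<in> generated_by gen - {0}"
    using assms(2) by (auto intro: generator_in_generated_by)
qed (use Min_le_generated_by in auto)

section \<open>The effect of a pass\<close>

lemma pass_eq_fold_pairs:
  "pass m T = fold (\<lambda>(i, j). relax m i j)
     (concat (map (\<lambda>i. map (Pair i) [i..<m]) [1..<m])) (T, False)"
proof -
  have "fold (\<lambda>i. fold (\<lambda>j. relax m i j) (js i)) is st
      = fold (\<lambda>(i, j). relax m i j) (concat (map (\<lambda>i. map (Pair i) (js i)) is)) st" for js "is" st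
    by (induction "is" arbitrary: st) (simp_all add: fold_map comp_def)
  then show ?thesis unfolding pass_def .
qed

text \<open>
  A later assignment can never restore an earlier value, because entries only decrease.  Hence the
  flag records whether the table as a whole differs from the old one, and if it does not, then all
  comparisons were made on one and the same table.
\<close>
lemma fold_relax:
  assumes "fold (\<lambda>(i, j). relax m i j) ps (T, c) = (T', c')"
    and "length T = m" and "0 < m"
  shows "list_all2 (\<le>) T' T"
    and "c' \<longleftrightarrow> c \<or> T' \<noteq> T"
    and "T' = T \<Longrightarrow> \<forall>(i, j)\<in>set ps. T ! ((i + j) mod m) \<le> T ! i + T ! j"
proof -
  have "list_all2 (\<le>) T' T \<and> (c' \<longleftrightarrow> c \<or> T' \<noteq> T) \<and>
      (T' = T \<longrightarrow> (\<forall>(i, j)\<in>set ps. T ! ((i + j) mod m) \<le> T ! i + T ! j))"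
    using assms(1,2)
  proof (induction ps arbitrary: T c)
    case Nil
    then show ?case by (auto intro: list_all2_refl)
  next
    case (Cons p ps)
    obtain i j where p: "p = (i, j)" by (cases p)
    let ?r = "(i + j) mod m"
    let ?v = "T ! i + T ! j"
    have r: "?r < length T" using Cons.prems(2) \<open>0 < m\<close> by simp
    show ?case
    proof (cases "T ! ?r > ?v")
      case False
      then have "relax m i j (T, c) = (T, c)" by (simp add: relax_def Let_def)
      then have "fold (\<lambda>(i, j). relax m i j) ps (T, c) = (T', c')"
        using Cons.prems(1) p by simp
      from Cons.IH[OF this Cons.prems(2)] show ?thesis
        using False p by (simp add: not_less)
    next
      case True
      let ?T1 = "T[?r := ?v]"
      have "relax m i j (T, c) = (?T1, True)" using True by (simp add: relax_def Let_def)
      then have "fold (\<lambda>(i, j). relax m i j) ps (?T1, True) = (T', c')"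
        using Cons.prems(1) p by simp
      from Cons.IH[OF this] have le1: "list_all2 (\<le>) T' ?T1" and c': c'
        using Cons.prems(2) by auto
      have "T' ! ?r \<le> ?v" using list_all2_nthD2[OF le1, of ?r] r by simp
      with True have "T' \<noteq> T" by auto
      moreover have le: "list_all2 (\<le>) ?T1 T"
      proof (rule list_all2_all_nthI)
        show "?T1 ! k \<le> T ! k" if "k < length ?T1" for k
          using that True by (cases "k = ?r") auto
      qed simp
      have "list_all2 (\<le>) T' T"
        by (rule list_all2_trans[OF _ le1 le]) (rule order_trans)
      ultimately show ?thesis using c' by simp
    qed
  qed
  then show "list_all2 (\<le>) T' T"
    and "c' \<longleftrightarrow> c \<or> T' \<noteq> T"
    and "T' = T \<Longrightarrow> \<forall>(i, j)\<in>set ps. T ! ((i + j) mod m) \<le> T ! i + T ! j"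
    by blast+
qed

definition closed_table :: "nat \<Rightarrow> enat list \<Rightarrow> bool" where
  "closed_table m T \<longleftrightarrow>
     (\<forall>i\<in>{1..<m}. \<forall>j\<in>{1..<m}. T ! ((i + j) mod m) \<le> T ! i + T ! j)"

lemma pass_decreases:
  assumes "pass m T = (T', c')" and "length T = m" and "0 < m"
  shows "list_all2 (\<le>) T' T"
    and "c' \<longleftrightarrow> T' \<noteq> T"
    and "\<not> c' \<Longrightarrow> closed_table m T'"
proof -
  note pass = fold_relax[OF assms(1)[unfolded pass_eq_fold_pairs] assms(2,3)]
  show "list_all2 (\<le>) T' T" by (rule pass(1))
  show changed: "c' \<longleftrightarrow> T' \<noteq> T" using pass(2) by simp
  assume "\<not> c'"
  with changed have T': "T' = T" by simp
  have ordered: "T ! ((i + j) mod m) \<le> T ! i + T ! j" if "1 \<le> i" "i \<le> j" "j < m" for i j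
  proof -
    have "(i, j) \<in> set (concat (map (\<lambda>i. map (Pair i) [i..<m]) [1..<m]))"
      using that by (auto intro!: bexI[of _ i])
    with pass(3)[OF T'] show ?thesis by blast
  qed
  \<comment> \<open>The pass inspects only pairs with \<open>i \<le> j\<close>; the other pairs follow by commutativity.\<close>
  show "closed_table m T'"
    unfolding closed_table_def T'
  proof (intro ballI)
    fix i j assume "i \<in> {1..<m}" "j \<in> {1..<m}"
    then show "T ! ((i + j) mod m) \<le> T ! i + T ! j"
      using ordered[of i j] ordered[of j i] by (cases "i \<le> j") (auto simp: add.commute)
  qed
qed

section \<open>Termination\<close>

lemma list_all2_le_imp_lex:
  fixes xs ys :: "'a::order list"
  assumes "list_all2 (\<le>) xs ys" and "xs \<noteq> ys"
  shows "(xs, ys) \<in> lex {(x, y). x < y}"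
  using assms
proof (induction rule: list_all2_induct)
  case (Cons x xs y ys)
  then show ?case using list_all2_lengthD[OF Cons.hyps(2)] by (cases "x = y") auto
qed simp

text \<open>
  Infinite entries rule out the sum of the table as a measure; the lexicographic order does not
  mind them.  The flag is the last component because the final pass changes only the flag.  The
  relation has the shape that \<open>wf_while_option_Some\<close> asks for, with \<open>Q\<close> open for the invariant.
\<close>
lemma wf_pass:
  assumes "0 < m"
  shows "wf {(t, s). ((\<lambda>(T, c). length T = m \<and> Q T c) s \<and> (\<lambda>(T, c). c) s) \<and>
                      t = (\<lambda>(T, c). pass m T) s}"
    (is "wf ?R")
proof (rule wf_subset)
  show "wf (lex {(x :: enat, y). x < y} <*lex*> {(False, True)})"
    by (intro wf_lex_prod wf_lex wf wf_subset[OF wf_measure[of of_bool]]) auto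
  show "?R \<subseteq> lex {(x :: enat, y). x < y} <*lex*> {(False, True)}"
  proof (rule subrelI)
    fix t s assume "(t, s) \<in> ?R"
    moreover obtain T c T' c' where st: "s = (T, c)" "t = (T', c')" by (cases s, cases t)
    ultimately have "length T = m" c and pass: "pass m T = (T', c')" by simp_all
    then have step: "list_all2 (\<le>) T' T" "c' \<longleftrightarrow> T' \<noteq> T"
      using pass_decreases(1,2) assms by blast+
    show "(t, s) \<in> lex {(x :: enat, y). x < y} <*lex*> {(False, True)}"
    proof (cases "T' = T")
      case True
      then show ?thesis using step(2) \<open>c\<close> unfolding st by simp
    next
      case False
      show ?thesis unfolding st using list_all2_le_imp_lex[OF step(1) False] by simp
    qed
  qed
qed

section \<open>The entries stay in the semigroup\<close>

definition table_in :: "nat set \<Rightarrow> nat \<Rightarrow> enat list \<Rightarrow> bool" where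
  "table_in S m T \<longleftrightarrow> length T = m \<and>
     (\<forall>i<m. \<forall>x. T ! i = enat x \<longrightarrow> x \<in> S - {0} \<and> x mod m = i)"

lemma relax_invariant:
  assumes closed: "\<And>a b. a \<in> S \<Longrightarrow> b \<in> S \<Longrightarrow> a + b \<in> S"
    and "table_in S m T" "i < m" "j < m"
  shows "table_in S m (fst (relax m i j (T, c)))"
proof -
  let ?r = "(i + j) mod m"
  have "x \<in> S - {0} \<and> x mod m = ?r" if "T ! i + T ! j = enat x" for x
  proof -
    from that obtain a b where ab: "T ! i = enat a" "T ! j = enat b" "x = a + b"
      by (cases "T ! i"; cases "T ! j") auto
    then have "a \<in> S - {0}" "a mod m = i" "b \<in> S - {0}" "b mod m = j"
      using assms(2-4) unfolding table_in_def by auto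
    then show ?thesis using closed ab(3) by (auto simp: mod_add_eq)
  qed
  then have "table_in S m (T[?r := T ! i + T ! j])"
    using assms(2) unfolding table_in_def by (auto simp: nth_list_update)
  then show ?thesis using assms(2) by (simp add: relax_def Let_def)
qed

lemma pass_invariant:
  assumes closed: "\<And>a b. a \<in> S \<Longrightarrow> b \<in> S \<Longrightarrow> a + b \<in> S"
    and "table_in S m T"
  shows "table_in S m (fst (pass m T))"
proof -
  have "table_in S m (fst (fold (\<lambda>(i, j). relax m i j) ps (T, c)))"
    if "\<forall>(i, j)\<in>set ps. i < m \<and> j < m" for ps c
    using that assms(2)
  proof (induction ps arbitrary: T c)
    case (Cons p ps)
    obtain i j where p: "p = (i, j)" by (cases p)
    obtain T1 c1 where step: "relax m i j (T, c) = (T1, c1)" by fastforce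
    have "table_in S m T1"
      using relax_invariant[OF closed Cons.prems(2), of i j c] Cons.prems(1) p step by auto
    then show ?case using Cons p step by simp
  qed simp
  then show ?thesis unfolding pass_eq_fold_pairs by auto
qed

lemma length_init_table [simp]: "length (init_table m gen) = m"
  by (simp add: init_table_def)

lemma init_table_in:
  assumes "\<forall>t\<in>set gen. 0 < t"
  shows "table_in (generated_by gen) m (init_table m gen)"
  unfolding table_in_def
proof (intro conjI allI impI)
  fix i x assume "i < m" and eq: "init_table m gen ! i = enat x"
  let ?A = "enat ` {t \<in> set gen. [t = i] (mod m)}"
  have inf: "Inf ?A = enat x" using eq \<open>i < m\<close> by (simp add: init_table_def)
  have nonempty: "?A \<noteq> {}"
  proof
    assume "?A = {}"
    then have "Inf ?A = \<infinity>" by (simp add: Inf_enat_def)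
    with inf show False by simp
  qed
  then obtain y where "y \<in> ?A" by blast
  then have "(LEAST y. y \<in> ?A) \<in> ?A" by (rule LeastI)
  then have "Inf ?A \<in> ?A" using nonempty by (simp only: Inf_enat_def if_False)
  then have "x \<in> set gen" "x mod m = i"
    using \<open>i < m\<close> unfolding inf by (auto simp: cong_def)
  then show "x \<in> generated_by gen - {0}" "x mod m = i"
    using assms by (auto intro: generator_in_generated_by)
qed simp

lemma init_table_le_generator:
  assumes "t \<in> set gen" and "0 < m"
  shows "init_table m gen ! (t mod m) \<le> enat t"
  using assms by (auto simp: init_table_def cong_def intro!: INF_lower)

section \<open>Closed tables bound the semigroup from below\<close>

text \<open>
  When one summand of \<open>y + t\<close> is divisible by \<open>m\<close>, the sum lies in the class of the other summand,
  whose entry is bounded already.  Closedness is therefore only called for at nonzero residues,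
  which is why the algorithm may start both loops at \<open>1\<close>.
\<close>
lemma closed_table_le:
  assumes closed: "closed_table m T" and "0 < m"
    and gen: "\<And>t. t \<in> set gen \<Longrightarrow> T ! (t mod m) \<le> enat t"
    and "x \<in> generated_by gen" and "x \<noteq> 0"
  shows "T ! (x mod m) \<le> enat x"
proof -
  from assms(4) have "x = 0 \<or> T ! (x mod m) \<le> enat x"
  proof (induction rule: generated_by_induct)
    case (add t y)
    show ?case
    proof (cases "y mod m = 0 \<or> t mod m = 0")
      case True
      then show ?thesis
      proof (elim disjE)
        assume "y mod m = 0"
        then have "(y + t) mod m = t mod m" by (metis add_0 mod_add_left_eq)
        moreover have "T ! (t mod m) \<le> enat (y + t)"
          by (rule order_trans[OF gen[OF add(1)]]) simp
        ultimately show ?thesis by simp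
      next
        assume t: "t mod m = 0"
        show ?thesis
        proof (cases "y = 0")
          case True
          then show ?thesis using gen[OF add(1)] by simp
        next
          case False
          have "(y + t) mod m = y mod m" using t by (metis add.right_neutral mod_add_right_eq)
          moreover have "T ! (y mod m) \<le> enat (y + t)"
            by (rule order_trans[of _ "enat y"]) (use add(2) False in auto)
          ultimately show ?thesis by simp
        qed
      qed
    next
      case False
      then have y: "T ! (y mod m) \<le> enat y" using add(2) by auto
      have "T ! ((y mod m + t mod m) mod m) \<le> T ! (y mod m) + T ! (t mod m)"
        using closed False \<open>0 < m\<close> unfolding closed_table_def by auto
      also have "\<dots> \<le> enat y + enat t" by (intro add_mono y gen add(1))
      finally show ?thesis by (simp add: mod_add_eq)
    qed
  qed simp
  with \<open>x \<noteq> 0\<close> show ?thesis by simp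
qed

lemma numerical_semigroup_residue:
  assumes "numerical_semigroup S" and "i < m"
  obtains x where "x \<in> S" "x mod m = i"
proof -
  from assms(1) have "finite (UNIV - S)" by (simp add: numerical_semigroup_def)
  moreover have "infinite (range (\<lambda>k. i + m * k))"
    using assms(2) by (intro range_inj_infinite injI) auto
  ultimately have "\<not> range (\<lambda>k. i + m * k) \<subseteq> UNIV - S"
    using finite_subset by blast
  then obtain k where "i + m * k \<in> S" by blast
  then show thesis using that[of "i + m * k"] assms(2) by simp
qed

lemma closed_table_eq_standard_basis:
  assumes S: "S = generated_by gen" "numerical_semigroup S"
    and gen: "gen \<noteq> []" "\<forall>t\<in>set gen. 0 < t"
    and m: "m = Min (set gen)"
    and T: "table_in S m T" "closed_table m T"
    and le: "\<And>t. t \<in> set gen \<Longrightarrow> T ! (t mod m) \<le> enat t"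
  shows "T = map enat (standard_basis S)"
proof -
  have mult: "semigroup_multiplicity S = m"
    unfolding S(1) m by (rule semigroup_multiplicity_generated_by[OF gen])
  have "m \<in> set gen" unfolding m using gen(1) by simp
  then have "0 < m" using gen(2) by blast
  have len: "length T = m" using T(1) by (simp add: table_in_def)
  have upper: "T ! (x mod m) \<le> enat x" if "x \<in> S" "x \<noteq> 0" for x
    using closed_table_le[OF T(2) \<open>0 < m\<close> le] that S(1) by blast
  have entry: "T ! 0 = enat m"
  proof -
    have "T ! 0 \<le> enat m" using le[OF \<open>m \<in> set gen\<close>] by simp
    then obtain x where x: "T ! 0 = enat x" "x \<le> m" by (cases "T ! 0") auto
    then have "x \<in> S - {0}" using T(1) \<open>0 < m\<close> by (auto simp: table_in_def)
    then have "m \<le> x" using Min_le_generated_by[of x gen] S(1) m by auto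
    with x show ?thesis by simp
  qed
  have entries: "T ! i = enat (LEAST x. x \<in> S \<and> [x = i] (mod m))" if "1 \<le> i" "i < m" for i
  proof -
    have residue: "[x = i] (mod m) \<longleftrightarrow> x mod m = i" for x
      using that by (simp add: cong_def)
    have nonzero: "x \<noteq> 0" if "x mod m = i" for x using that \<open>1 \<le> i\<close> by (cases "x = 0") auto
    obtain x where x: "x \<in> S" "x mod m = i"
      using numerical_semigroup_residue[OF S(2) \<open>i < m\<close>] .
    obtain h where h: "T ! i = enat h"
      using upper[OF x(1) nonzero[OF x(2)]] x(2) by (cases "T ! i") auto
    have "(LEAST x. x \<in> S \<and> [x = i] (mod m)) = h"
      unfolding residue
    proof (rule Least_equality)
      show "h \<in> S \<and> h mod m = i" using T(1) h \<open>i < m\<close> by (auto simp: table_in_def)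
      show "h \<le> y" if "y \<in> S \<and> y mod m = i" for y
        using upper[of y] nonzero[of y] that h by auto
    qed
    then show ?thesis using h by simp
  qed
  show ?thesis
  proof (rule nth_equalityI)
    show "length T = length (map enat (standard_basis S))"
      using len \<open>0 < m\<close> by (simp add: standard_basis_def mult Let_def)
    show "T ! i = map enat (standard_basis S) ! i" if "i < length T" for i
      using that len entry entries[of i]
      by (cases i) (auto simp: standard_basis_def mult Let_def nth_Cons' simp del: upt_Suc)
  qed
qed

section \<open>Correctness of the algorithm\<close>

theorem mainTheorem3:
  fixes s :: "nat list" and S :: "nat set"
  assumes "\<forall>x\<in>set s. 0 < x"
    and "S = generated_by s"
    and "numerical_semigroup S"
  shows "StdBasis s = Some (map enat (standard_basis S))"
proof -
  have "s \<noteq> []"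
  proof
    assume "s = []"
    then have "S = {0}" using assms(2) by (simp add: generated_by_def)
    then show False using assms(3) by (simp add: numerical_semigroup_def)
  qed
  define m where "m = Min (set s)"
  have "m \<in> set s" unfolding m_def using \<open>s \<noteq> []\<close> by simp
  then have "0 < m" using assms(1) by blast
  define Q where "Q T c \<longleftrightarrow> table_in S m T \<and> list_all2 (\<le>) T (init_table m s) \<and>
      (\<not> c \<longrightarrow> closed_table m T)" for T c
  let ?P = "\<lambda>(T, c). length T = m \<and> Q T c"
  let ?b = "\<lambda>(T :: enat list, c). c"
  let ?c = "\<lambda>(T, c :: bool). pass m T"
  have init: "?P (init_table m s, True)"
    using init_table_in[OF assms(1)] assms(2) by (auto simp: Q_def intro: list_all2_refl)
  have step: "?P (?c st)" if P: "?P st" for st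
  proof -
    obtain T c where st: "st = (T, c)" by (cases st)
    obtain T' c' where pass: "pass m T = (T', c')" by fastforce
    have len: "length T = m" and T: "table_in S m T" "list_all2 (\<le>) T (init_table m s)"
      using P st by (auto simp: Q_def)
    have closed: "a + b \<in> S" if "a \<in> S" "b \<in> S" for a b
      using assms(3) that by (simp add: numerical_semigroup_def)
    have "table_in S m T'" using pass_invariant[OF closed T(1)] pass by simp
    moreover note decr = pass_decreases[OF pass len \<open>0 < m\<close>]
    have "list_all2 (\<le>) T' (init_table m s)"
      by (rule list_all2_trans[OF _ decr(1) T(2)]) (rule order_trans)
    moreover have "length T' = m" using list_all2_lengthD[OF decr(1)] len by simp
    ultimately show ?thesis using decr(3) pass st by (auto simp: Q_def)
  qed
  obtain st where st: "while_option ?b ?c (init_table m s, True) = Some st"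
    using wf_while_option_Some[of ?P ?b ?c, OF wf_pass[OF \<open>0 < m\<close>] step init] by blast
  obtain T c where Tc: "st = (T, c)" by (cases st)
  have "?P st" using while_option_rule[of ?P ?b ?c, OF step st init] .
  moreover have "\<not> c" using while_option_stop[OF st] Tc by simp
  ultimately have T: "table_in S m T" "closed_table m T" "list_all2 (\<le>) T (init_table m s)"
    using Tc by (auto simp: Q_def)
  have le: "T ! (t mod m) \<le> enat t" if "t \<in> set s" for t
    using list_all2_nthD2[OF T(3), of "t mod m"] init_table_le_generator[OF that \<open>0 < m\<close>] \<open>0 < m\<close>
    by (auto intro: order_trans)
  have "T = map enat (standard_basis S)"
    by (rule closed_table_eq_standard_basis[OF assms(2,3) \<open>s \<noteq> []\<close> assms(1) m_def T(1,2) le])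
  then show ?thesis using st Tc by (simp add: StdBasis_def Let_def m_def)
qed

end
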